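(* Let $K$ be a field and let $\{X_n\}_{n\in\mathbb{N}}$ be a countably infinite collection of indeterminates over $K$. The ring $D = K[\{X_iX_j\}_{i,j\in\mathbb{N}}]$ (the $K$-subalgebra of the polynomial ring $K[\{X_n\}_{n\in\mathbb{N}}]$ generated by all products $X_iX_j$) is a Bezout Intersection domain.
   Context: Elements $a_1,\dots,a_n$ ($n\ge 2$) of an integral domain $D$ are pairwise incomparable if $a_i\notin (a_j)$ for all $i\neq j$. An integral domain $D$ is a Bezout Intersection domain (BID) if for every finite collection of pairwise incomparable elements $a_1,\dots,a_n\in D$ the ideal $(a_1)\cap\dots\cap(a_n)$ is either principal or not finitely generated. *)

theory Defs
  imports "HOL-Algebra.Algebra" "HOL-Algebra.Algebraic_Closure_Type" "HOL-Library.Poly_Mapping"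
begin

section \<open>Bezout Intersection domains\<close>

definition pairwise_incomparable :: "('a, 'b) ring_scheme \<Rightarrow> nat \<Rightarrow> (nat \<Rightarrow> 'a) \<Rightarrow> bool" where
  "pairwise_incomparable R n a \<longleftrightarrow>
     (\<forall>i<n. \<forall>j<n. i \<noteq> j \<longrightarrow> a i \<notin> PIdl\<^bsub>R\<^esub> (a j))"

definition finitely_generated_ideal :: "'a set \<Rightarrow> ('a, 'b) ring_scheme \<Rightarrow> bool" where
  "finitely_generated_ideal I R \<longleftrightarrow> (\<exists>S \<subseteq> carrier R. finite S \<and> I = Idl\<^bsub>R\<^esub> S)"

definition bezout_intersection_domain :: "('a, 'b) ring_scheme \<Rightarrow> bool" where
  "bezout_intersection_domain R \<longleftrightarrow>
     domain R \<and>
     (\<forall>n a. n \<ge> 2 \<longrightarrow> (\<forall>i<n. a i \<in> carrier R) \<longrightarrow> pairwise_incomparable R n a \<longrightarrow>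
        principalideal (\<Inter>i<n. PIdl\<^bsub>R\<^esub> (a i)) R \<or>
        \<not> finitely_generated_ideal (\<Inter>i<n. PIdl\<^bsub>R\<^esub> (a i)) R)"


section \<open>The ring generated by the quadratic monomials\<close>

text \<open>
  Polynomials over \<open>'k\<close> in the indeterminates \<open>indet 0, indet 1, indet 2, \<dots>\<close>: an exponent vector is a
  finitely supported function from the indices of the indeterminates to \<open>nat\<close>, and a polynomial is
  a finitely supported function from exponent vectors to coefficients, multiplied by convolution.
\<close>

type_synonym 'k poly_inf = "(nat \<Rightarrow>\<^sub>0 nat) \<Rightarrow>\<^sub>0 'k"

definition const_inf :: "'k::field \<Rightarrow> 'k poly_inf" where
  "const_inf c = Poly_Mapping.single 0 c"

definition indet :: "nat \<Rightarrow> 'k::field poly_inf" where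
  "indet i = Poly_Mapping.single (Poly_Mapping.single i 1) 1"

text \<open>
  The \<open>'k\<close>-subalgebra generated by the products \<open>indet i * indet j\<close> (with \<open>i = j\<close> allowed) is the
  smallest subring of the polynomial ring that contains these products and all constants.
\<close>

definition quadratic_subalgebra :: "'k::field poly_inf ring" where
  "quadratic_subalgebra =
     ring_of_type_algebra
       \<lparr>carrier := generate_ring ring_of_type_algebra
          (range const_inf \<union> {indet i * indet j | i j. True})\<rparr>"

end

theory Submission
  imports Defs
begin

text \<open>
  Let \<open>R\<close> be the polynomial ring in all indeterminates. The given subalgebra is the ring \<open>evens\<close>
  of the polynomials whose monomials all have even total degree
  (\<open>carrier_quadratic_subalgebra\<close>): it is the degree-zero part of \<open>R\<close> for the grading of \<open>R\<close> by
  the parity of the total degree, and the polynomials in \<open>odds\<close> form the other part. If \<open>a\<close> is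
  even and nonzero and \<open>a q\<close> is even, then \<open>q\<close> is even; so the principal ideal of \<open>a\<close> in the
  subalgebra consists of the even multiples of \<open>a\<close> in \<open>R\<close>.

  Divisibility in \<open>R\<close> is well behaved: any finite set of nonzero polynomials has a least common
  multiple \<open>L\<close> (\<open>ex_lcm\<close>). Hence the intersection of the principal ideals of even polynomials
  \<open>a\<^sub>1, \<dots>, a\<^sub>n\<close> is the set of even multiples of their least common multiple \<open>L\<close>. All \<open>a\<^sub>i\<close> divide
  the odd part of \<open>L\<close> along with \<open>L\<close>, so \<open>L\<close> divides its own odd part, and a comparison of degrees
  shows that the quotient is a constant. Thus \<open>L\<close> is even or odd (\<open>lcm_homogeneous\<close>).

  If \<open>L\<close> is even, then the intersection is the principal ideal of \<open>L\<close>. If \<open>L\<close> is odd, then it is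
  \<open>L\<close> times the set of all odd polynomials. That set is not a finitely generated module over the
  even polynomials: an indeterminate that occurs in none of finitely many odd polynomials is not a
  combination of them with even coefficients, since in degree one only the constant terms of the
  coefficients count (\<open>odd_multiples_not_finitely_generated\<close>). So in this case the intersection
  is not finitely generated.

  Least common multiples come from unique factorisation. Factorisations into irreducibles exist
  because of the total degree; the substance is that irreducible polynomials are prime
  (\<open>irreducible_imp_prime_elem\<close>). Since only finitely many indeterminates occur in a given
  instance of that claim, it is enough to adjoin one indeterminate at a time. The ring of
  polynomials in a set \<open>V\<close> of indeterminates is treated as the subset \<open>polys_in V\<close> of \<open>R\<close>. It is
  closed under taking divisors of nonzero elements, so that divisibility, units and irreducibility
  all have the same meaning in \<open>polys_in V\<close> as in \<open>R\<close>.
\<close>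

abbreviation keys :: "('a \<Rightarrow>\<^sub>0 'b::zero) \<Rightarrow> 'a set" where "keys \<equiv> Poly_Mapping.keys"
abbreviation lookup :: "('a \<Rightarrow>\<^sub>0 'b::zero) \<Rightarrow> 'a \<Rightarrow> 'b" where "lookup \<equiv> Poly_Mapping.lookup"
abbreviation single :: "'a \<Rightarrow> 'b::zero \<Rightarrow> ('a \<Rightarrow>\<^sub>0 'b)" where "single \<equiv> Poly_Mapping.single"

section \<open>Restricting a polynomial to a set of monomials\<close>

definition restr :: "'m set \<Rightarrow> ('m \<Rightarrow>\<^sub>0 'b::zero) \<Rightarrow> 'm \<Rightarrow>\<^sub>0 'b" where
  "restr M p = Poly_Mapping.mapp (\<lambda>m c. c when m \<in> M) p"

lemma lookup_restr: "lookup (restr M p) m = (if m \<in> M then lookup p m else 0)"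
  by (auto simp: restr_def lookup_mapp when_def in_keys_iff)

lemma keys_restr: "keys (restr M p) = keys p \<inter> M"
  by (auto simp: in_keys_iff lookup_restr split: if_splits)

lemma restr_add: "restr M (p + q) = restr M p + restr M q"
  by (rule poly_mapping_eqI) (simp add: lookup_restr lookup_add)

lemma restr_split: "restr M p + restr (- M) p = p"
  by (rule poly_mapping_eqI) (simp add: lookup_restr lookup_add)

lemma restr_id_iff: "restr M p = p \<longleftrightarrow> keys p \<subseteq> M"
proof
  show "restr M p = p \<Longrightarrow> keys p \<subseteq> M"
    by (metis keys_restr inf.cobounded2)
  show "keys p \<subseteq> M \<Longrightarrow> restr M p = p"
    by (rule poly_mapping_eqI) (auto simp: lookup_restr in_keys_iff)
qed

lemma restr_eq_0_iff: "restr M p = 0 \<longleftrightarrow> keys p \<inter> M = {}"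
proof
  show "restr M p = 0 \<Longrightarrow> keys p \<inter> M = {}"
    by (metis keys_restr keys_zero)
  show "keys p \<inter> M = {} \<Longrightarrow> restr M p = 0"
    by (rule poly_mapping_eqI) (auto simp: lookup_restr in_keys_iff)
qed

lemma in_keys_multE:
  assumes "m \<in> keys (p * q)"
  obtains a b where "a \<in> keys p" "b \<in> keys q" "m = a + b"
  using assms keys_mult[of p q] by blast

text \<open>
  If shifting by the monomials of \<open>p\<close> turns membership in \<open>M'\<close> into membership in \<open>M\<close>, then \<open>p\<close>
  behaves as a homogeneous element for the splitting by these sets. This is applied to the degree in
  one indeterminate and to the parity of the total degree.
\<close>
lemma restr_mult:
  fixes p q :: "'m::monoid_add \<Rightarrow>\<^sub>0 'b::semiring_0"
  assumes "\<And>a m. a \<in> keys p \<Longrightarrow> a + m \<in> M \<longleftrightarrow> m \<in> M'"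
  shows "restr M (p * q) = p * restr M' q"
proof -
  have "restr M (p * restr M' q) = p * restr M' q"
    by (auto simp: restr_id_iff keys_restr assms elim!: in_keys_multE)
  moreover have "restr M (p * restr (- M') q) = 0"
    by (auto simp: restr_eq_0_iff keys_restr assms elim!: in_keys_multE)
  ultimately show ?thesis
    by (metis restr_split distrib_left restr_add add.right_neutral)
qed

section \<open>Degrees\<close>

text \<open>
  The weighted degree covers the total degree as well as the degree in a single indeterminate.
  Its value at \<open>0\<close>, the maximum of the empty set, is unspecified.
\<close>
definition wdeg :: "('m \<Rightarrow> nat) \<Rightarrow> ('m \<Rightarrow>\<^sub>0 'b::zero) \<Rightarrow> nat" where
  "wdeg w p = Max (w ` keys p)"

lemma keys_nonempty: "p \<noteq> 0 \<Longrightarrow> keys p \<noteq> {}"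
  by (metis poly_mapping_eqI lookup_zero in_keys_iff empty_iff)

lemma le_wdeg: "m \<in> keys p \<Longrightarrow> w m \<le> wdeg w p"
  by (simp add: wdeg_def)

lemma wdeg_attained:
  assumes "p \<noteq> 0" obtains m where "m \<in> keys p" "w m = wdeg w p"
proof -
  have "Max (w ` keys p) \<in> w ` keys p"
    using keys_nonempty[OF assms] by (intro Max_in) auto
  thus ?thesis using that by (metis wdeg_def imageE)
qed

lemma wdeg_eqI: "m \<in> keys p \<Longrightarrow> w m = d \<Longrightarrow> (\<And>m. m \<in> keys p \<Longrightarrow> w m \<le> d) \<Longrightarrow> wdeg w p = d"
  unfolding wdeg_def by (intro Max_eqI) auto

text \<open>
  The product of the parts of top weight is nonzero because there are no zero divisors, and it is
  the part of weight \<open>wdeg w p + wdeg w q\<close> of the product.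
\<close>
lemma wdeg_mult:
  fixes p q :: "'m::{ordered_cancel_comm_monoid_add, linorder} \<Rightarrow>\<^sub>0 'b::idom"
  assumes w: "\<And>a b. w (a + b) = w a + w b" and nz: "p \<noteq> 0" "q \<noteq> 0"
  shows "wdeg w (p * q) = wdeg w p + wdeg w q"
proof -
  define P where "P = {m. w m = wdeg w p}"
  define Q where "Q = {m. w m = wdeg w q}"
  define N where "N = {m. w m = wdeg w p + wdeg w q}"
  have "restr P p \<noteq> 0" "restr Q q \<noteq> 0"
    using nz by (auto simp: restr_eq_0_iff P_def Q_def elim: wdeg_attained)
  hence nz': "restr P p * restr Q q \<noteq> 0"
    by simp
  have "restr N (restr P p * q) = restr P p * restr Q q"
    by (rule restr_mult) (auto simp: keys_restr P_def Q_def N_def w)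
  moreover have "restr N (restr (- P) p * q) = 0"
  proof -
    have "w m \<noteq> wdeg w p + wdeg w q" if "m \<in> keys (restr (- P) p * q)" for m
    proof -
      from that obtain a b where ab: "a \<in> keys p" "a \<notin> P" "b \<in> keys q" "m = a + b"
        by (auto simp: keys_restr elim!: in_keys_multE)
      hence "w a < wdeg w p" "w b \<le> wdeg w q"
        using le_wdeg[of a p w] le_wdeg[of b q w] by (auto simp: P_def)
      thus ?thesis using ab w by simp
    qed
    thus ?thesis by (auto simp: restr_eq_0_iff N_def)
  qed
  ultimately have "restr N (p * q) \<noteq> 0"
    using nz' by (metis restr_split distrib_right restr_add add.right_neutral)
  then obtain m where "m \<in> keys (p * q)" "w m = wdeg w p + wdeg w q"
    by (auto simp: restr_eq_0_iff N_def)
  thus ?thesis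
  proof (rule wdeg_eqI)
    fix m assume "m \<in> keys (p * q)"
    then obtain a b where "a \<in> keys p" "b \<in> keys q" "m = a + b" by (rule in_keys_multE)
    thus "w m \<le> wdeg w p + wdeg w q"
      using w le_wdeg[of a p w] le_wdeg[of b q w] by (simp add: add_mono)
  qed
qed

type_synonym ('v, 'k) mpoly = "('v \<Rightarrow>\<^sub>0 nat) \<Rightarrow>\<^sub>0 'k"

definition mdeg :: "('v \<Rightarrow>\<^sub>0 nat) \<Rightarrow> nat" where
  "mdeg m = (\<Sum>v\<in>keys m. lookup m v)"

lemma mdeg_add: "mdeg (a + b) = mdeg a + mdeg b"
  unfolding mdeg_def by (rule setsum_keys_plus_distrib) auto

lemma mdeg_single [simp]: "mdeg (single v n) = n"
  by (simp add: mdeg_def)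

lemma mdeg_0 [simp]: "mdeg 0 = 0"
  by (simp add: mdeg_def)

lemma mdeg_eq_0_iff [simp]: "mdeg m = 0 \<longleftrightarrow> m = 0"
  by (auto simp: mdeg_def in_keys_iff intro: poly_mapping_eqI)

abbreviation tdeg :: "('v, 'k::zero) mpoly \<Rightarrow> nat" where
  "tdeg \<equiv> wdeg mdeg"

lemma tdeg_mult:
  fixes p q :: "('v::linorder, 'k::idom) mpoly"
  shows "p \<noteq> 0 \<Longrightarrow> q \<noteq> 0 \<Longrightarrow> tdeg (p * q) = tdeg p + tdeg q"
  by (rule wdeg_mult) (auto simp: mdeg_add)

lemma is_unit_iff_tdeg:
  fixes p :: "('v::linorder, 'k::field) mpoly"
  assumes "p \<noteq> 0"
  shows "p dvd 1 \<longleftrightarrow> tdeg p = 0"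
proof
  assume "p dvd 1"
  then obtain q where q: "1 = p * q" by (rule dvdE)
  hence "q \<noteq> 0" by auto
  hence "tdeg p + tdeg q = tdeg (1 :: ('v, 'k) mpoly)"
    using q assms by (metis tdeg_mult)
  also have "\<dots> = 0" by (auto simp: wdeg_def)
  finally show "tdeg p = 0" by simp
next
  assume "tdeg p = 0"
  hence "keys p \<subseteq> {0}" using le_wdeg[of _ p mdeg] by fastforce
  hence p: "p = single 0 (lookup p 0)"
    by (intro poly_mapping_eqI) (auto simp: lookup_single when_def in_keys_iff)
  hence "lookup p 0 \<noteq> 0" using assms by auto
  hence "p * single 0 (inverse (lookup p 0)) = 1"
    by (subst p) (simp add: mult_single)
  thus "p dvd 1" by (metis dvdI)
qed

lemma keys_unit:
  fixes p :: "('v::linorder, 'k::field) mpoly"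
  assumes "p dvd 1"
  shows "keys p \<subseteq> {0}"
proof -
  have "p \<noteq> 0" using assms by auto
  hence "tdeg p = 0" using is_unit_iff_tdeg[of p] assms by blast
  thus ?thesis using le_wdeg[of _ p mdeg] by fastforce
qed

lemma ex_irreducible_factor:
  fixes p :: "('v::linorder, 'k::field) mpoly"
  assumes "p \<noteq> 0" "\<not> p dvd 1"
  obtains q where "Factorial_Ring.irreducible q" "q dvd p"
proof -
  have "\<exists>q. Factorial_Ring.irreducible q \<and> q dvd p"
    using assms
  proof (induction "tdeg p" arbitrary: p rule: less_induct)
    case less
    show ?case
    proof (cases "Factorial_Ring.irreducible p")
      case False
      then obtain a b where ab: "p = a * b" "\<not> a dvd 1" "\<not> b dvd 1"
        using less.prems by (auto simp: Factorial_Ring.irreducible_def)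
      hence "a \<noteq> 0" "b \<noteq> 0" using less.prems by auto
      hence "tdeg a < tdeg p"
        using ab is_unit_iff_tdeg[of b] by (simp add: tdeg_mult)
      thus ?thesis using less.hyps[of a] ab \<open>a \<noteq> 0\<close> by auto
    qed auto
  qed
  thus ?thesis using that by blast
qed

text \<open>
  Induction along a factorisation into irreducibles; it ends because each irreducible factor has
  positive total degree.
\<close>
lemma factorisation_induct [consumes 1, case_names unit mult]:
  fixes p :: "('v::linorder, 'k::field) mpoly"
  assumes "p \<noteq> 0"
    and unit: "\<And>u. u dvd 1 \<Longrightarrow> P u"
    and mult: "\<And>q p. Factorial_Ring.irreducible q \<Longrightarrow> p \<noteq> 0 \<Longrightarrow> P p \<Longrightarrow> P (q * p)"
  shows "P p"
  using assms(1)
proof (induction "tdeg p" arbitrary: p rule: less_induct)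
  case less
  show ?case
  proof (cases "p dvd 1")
    case False
    then obtain q where q: "Factorial_Ring.irreducible q" "q dvd p"
      using ex_irreducible_factor less.prems by blast
    then obtain r where r: "p = q * r" by blast
    hence nz: "q \<noteq> 0" "r \<noteq> 0" using less.prems by auto
    have "tdeg q \<noteq> 0" using q nz is_unit_iff_tdeg[of q] irreducible_not_unit by auto
    hence "tdeg r < tdeg p" using r nz by (simp add: tdeg_mult)
    thus ?thesis using mult less.hyps q r nz by auto
  qed (rule unit)
qed

section \<open>Polynomials in a set of indeterminates\<close>

definition polys_in :: "'v set \<Rightarrow> ('v, 'k::zero) mpoly set" where
  "polys_in V = {p. \<forall>m\<in>keys p. keys m \<subseteq> V}"

lemma polys_in_mono: "V \<subseteq> W \<Longrightarrow> p \<in> polys_in V \<Longrightarrow> p \<in> polys_in W"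
  by (auto simp: polys_in_def)

lemma polys_in_0 [simp]: "0 \<in> polys_in V" 
  by (simp add: polys_in_def)

lemma polys_in_1 [simp]: "(1 :: ('v, 'k::zero_neq_one) mpoly) \<in> polys_in V"
  by (simp add: polys_in_def)

lemma polys_in_add: "p \<in> polys_in V \<Longrightarrow> q \<in> polys_in V \<Longrightarrow> p + q \<in> polys_in V"
  using keys_add[of p q] by (auto simp: polys_in_def)

lemma polys_in_diff:
  fixes p q :: "('v, 'k::ring_1) mpoly"
  shows "p \<in> polys_in V \<Longrightarrow> q \<in> polys_in V \<Longrightarrow> p - q \<in> polys_in V"
  using polys_in_add[of p V "- q"] by (simp add: polys_in_def in_keys_iff)

lemma polys_in_mult: "p \<in> polys_in V \<Longrightarrow> q \<in> polys_in V \<Longrightarrow> p * q \<in> polys_in V"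
  unfolding polys_in_def by (auto elim!: in_keys_multE dest!: set_mp[OF keys_add])

lemma lookup_polys_in:
  assumes "p \<in> polys_in V" "m \<in> keys p" "i \<notin> V"
  shows "lookup m i = 0"
proof -
  have "i \<notin> keys m" using assms by (auto simp: polys_in_def)
  thus ?thesis by (simp add: in_keys_iff)
qed

lemma polys_in_iff_wdeg:
  "p \<noteq> 0 \<Longrightarrow> p \<in> polys_in V \<longleftrightarrow> (\<forall>v. v \<notin> V \<longrightarrow> wdeg (\<lambda>m. lookup m v) p = 0)"
proof safe
  fix v assume "p \<noteq> 0" "p \<in> polys_in V" "v \<notin> V"
  moreover from \<open>p \<noteq> 0\<close> obtain m where "m \<in> keys p" "lookup m v = wdeg (\<lambda>m. lookup m v) p"
    by (rule wdeg_attained)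
  ultimately show "wdeg (\<lambda>m. lookup m v) p = 0"
    by (metis lookup_polys_in)
next
  assume *: "\<forall>v. v \<notin> V \<longrightarrow> wdeg (\<lambda>m. lookup m v) p = 0"
  show "p \<in> polys_in V"
    unfolding polys_in_def
  proof safe
    fix m v assume "m \<in> keys p" "v \<in> keys m"
    thus "v \<in> V" using * le_wdeg[of m p "\<lambda>m. lookup m v"] by (auto simp: in_keys_iff)
  qed
qed

text \<open>
  Degrees in a single indeterminate add up in a product, so an indeterminate that occurs in a factor
  of a nonzero polynomial occurs in the polynomial itself.
\<close>
lemma polys_in_factor:
  fixes p q :: "('v::linorder, 'k::idom) mpoly"
  assumes "p * q \<in> polys_in V" "p * q \<noteq> 0"
  shows "p \<in> polys_in V" "q \<in> polys_in V"
proof -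
  have nz: "p \<noteq> 0" "q \<noteq> 0" using assms by auto
  have "wdeg (\<lambda>m. lookup m v) (p * q) = wdeg (\<lambda>m. lookup m v) p + wdeg (\<lambda>m. lookup m v) q" for v
    using nz by (intro wdeg_mult) (auto simp: lookup_add)
  thus "p \<in> polys_in V" "q \<in> polys_in V"
    using assms nz by (auto simp: polys_in_iff_wdeg)
qed

lemma is_unit_polys_in:
  fixes p :: "('v::linorder, 'k::field) mpoly"
  shows "p dvd 1 \<Longrightarrow> p \<in> polys_in V"
  using keys_unit[of p] by (auto simp: polys_in_def)

section \<open>Expansion in one indeterminate\<close>

abbreviation xpow :: "'v \<Rightarrow> nat \<Rightarrow> ('v, 'k::zero_neq_one) mpoly" where
  "xpow i n \<equiv> single (single i n) 1"

lemma xpow_add: "xpow i (a + b) = xpow i a * (xpow i b :: ('v, 'k::comm_semiring_1) mpoly)"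
  by (simp add: mult_single single_add)

lemma xpow_nonzero [simp]: "xpow i n \<noteq> (0 :: ('v, 'k::zero_neq_one) mpoly)"
  by (metis keys_single keys_zero insert_not_empty one_neq_zero)

lemma xpow_in_polys_in: "i \<in> V \<Longrightarrow> xpow i n \<in> polys_in V"
  by (auto simp: polys_in_def)

text \<open>
  A strict bound on the degree in \<open>i\<close>, instead of the degree itself, so that \<open>0\<close> is the case
  \<open>n = 0\<close> in the inductions below.
\<close>
definition deg_less :: "'v \<Rightarrow> nat \<Rightarrow> ('v, 'k::zero) mpoly \<Rightarrow> bool" where
  "deg_less i n p \<longleftrightarrow> (\<forall>m\<in>keys p. lookup m i < n)"

lemma deg_less_0_iff [simp]: "deg_less i 0 p \<longleftrightarrow> p = 0"
  using keys_nonempty by (auto simp: deg_less_def)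

lemma deg_less_wdeg: "p \<noteq> 0 \<Longrightarrow> deg_less i n p \<longleftrightarrow> wdeg (\<lambda>m. lookup m i) p < n"
  unfolding deg_less_def by (metis wdeg_attained le_wdeg le_less_trans)

lemma ex_deg_less: "\<exists>n. deg_less i n p"
  unfolding deg_less_def using le_wdeg[of _ p "\<lambda>m. lookup m i"] le_imp_less_Suc by blast

lemma deg_less_add: "deg_less i n p \<Longrightarrow> deg_less i n q \<Longrightarrow> deg_less i n (p + q)"
  using keys_add[of p q] by (auto simp: deg_less_def)

lemma deg_less_diff:
  fixes p q :: "('v, 'k::ring_1) mpoly"
  shows "deg_less i n p \<Longrightarrow> deg_less i n q \<Longrightarrow> deg_less i n (p - q)"
  using deg_less_add[of i n p "- q"] by (simp add: deg_less_def in_keys_iff)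

lemma deg_less_mult:
  fixes p q :: "('v, 'k::semiring_0) mpoly"
  shows "deg_less i (Suc a) p \<Longrightarrow> deg_less i b q \<Longrightarrow> deg_less i (a + b) (p * q)"
  unfolding deg_less_def by (fastforce simp: lookup_add elim!: in_keys_multE)

lemma deg_less_polys_in: "p \<in> polys_in V \<Longrightarrow> i \<notin> V \<Longrightarrow> deg_less i (Suc 0) p"
  by (auto simp: deg_less_def lookup_polys_in)

lemma deg_less_xpow: "deg_less i (Suc n) (xpow i n)"
  by (auto simp: deg_less_def)

lemma factor_xpow:
  fixes t :: "('v, 'k::comm_semiring_1) mpoly"
  assumes "t \<in> polys_in (insert i V)" and e: "\<And>m. m \<in> keys t \<Longrightarrow> lookup m i = e"
  obtains l where "l \<in> polys_in V" "t = l * xpow i e"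
proof -
  define l where "l = (\<Sum>m\<in>keys t. single (m - single i e) (lookup t m))"
  have "t = (\<Sum>m\<in>keys t. single m (lookup t m))"
    by (rule poly_mapping_eqI) (auto simp: lookup_sum lookup_single when_def in_keys_iff)
  also have "\<dots> = (\<Sum>m\<in>keys t. single (m - single i e) (lookup t m) * xpow i e)"
  proof (rule sum.cong)
    fix m assume "m \<in> keys t"
    hence "m - single i e + single i e = m"
      using e by (intro poly_mapping_eqI) (auto simp: lookup_add lookup_minus lookup_single when_def)
    thus "single m (lookup t m) = single (m - single i e) (lookup t m) * xpow i e"
      by (simp add: mult_single)
  qed simp
  also have "\<dots> = l * xpow i e"
    by (simp add: l_def sum_distrib_right)
  finally have "t = l * xpow i e" .
  moreover have "l \<in> polys_in V"
    unfolding polys_in_def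
  proof safe
    fix m v assume "m \<in> keys l" and v: "v \<in> keys m"
    then obtain m' where m': "m' \<in> keys t" "m = m' - single i e"
      unfolding l_def using keys_sum[of "\<lambda>m. single (m - single i e) (lookup t m)" "keys t"]
      by (auto split: if_splits)
    have "v \<noteq> i" "v \<in> keys m'"
      using v e[OF m'(1)] m'(2) by (auto simp: in_keys_iff lookup_minus lookup_single when_def)
    thus "v \<in> V" using assms(1) m'(1) by (auto simp: polys_in_def)
  qed
  ultimately show ?thesis using that by blast
qed

text \<open>
  The coefficient \<open>l\<close> at the power \<open>n\<close> of the indeterminate may be zero.
\<close>
lemma leading_coeff_split:
  fixes p :: "('v, 'k::comm_semiring_1) mpoly"
  assumes "p \<in> polys_in (insert i V)" "deg_less i (Suc n) p"
  obtains l r where "l \<in> polys_in V" "r \<in> polys_in (insert i V)" "deg_less i n r"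
    "p = l * xpow i n + r"
proof -
  define M where "M = {m :: 'v \<Rightarrow>\<^sub>0 nat. lookup m i = n}"
  have "restr M p \<in> polys_in (insert i V)"
    using assms(1) by (auto simp: polys_in_def keys_restr)
  then obtain l where l: "l \<in> polys_in V" "restr M p = l * xpow i n"
    by (rule factor_xpow[where e = n]) (auto simp: keys_restr M_def)
  show ?thesis
  proof (rule that[OF l(1)])
    show "restr (- M) p \<in> polys_in (insert i V)"
      using assms(1) by (auto simp: polys_in_def keys_restr)
    show "deg_less i n (restr (- M) p)"
      using assms(2) by (auto simp: deg_less_def keys_restr M_def less_Suc_eq)
    show "p = l * xpow i n + restr (- M) p"
      using l(2) restr_split by metis
  qed
qed

section \<open>Irreducible polynomials are prime\<close>

text \<open>
  The statement to be proved by induction on \<open>V\<close>. The factors \<open>g\<close> and \<open>h\<close> are confined to \<open>V\<close> as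
  well, so that the denominators that arise in the step from \<open>V\<close> to \<open>insert i V\<close> are polynomials
  in \<open>V\<close>, whose irreducible factors are covered by the induction hypothesis. The type argument
  names the coefficient field, which occurs only in bound variables.
\<close>
definition irreducibles_prime :: "'v::linorder set \<Rightarrow> 'k::field itself \<Rightarrow> bool" where
  "irreducibles_prime V k \<longleftrightarrow>
     (\<forall>p g h :: ('v, 'k) mpoly. p \<in> polys_in V \<longrightarrow> Factorial_Ring.irreducible p \<longrightarrow>
        g \<in> polys_in V \<longrightarrow> h \<in> polys_in V \<longrightarrow> p dvd g * h \<longrightarrow> p dvd g \<or> p dvd h)"

lemma irreducibles_primeD:
  fixes p g h :: "('v::linorder, 'k::field) mpoly"
  assumes "irreducibles_prime V TYPE('k)" "Factorial_Ring.irreducible p" "p dvd g * h"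
    "p \<in> polys_in V" "g \<in> polys_in V" "h \<in> polys_in V"
  shows "p dvd g \<or> p dvd h"
  using assms unfolding irreducibles_prime_def by blast

lemma dvd_leading_coeff:
  fixes p :: "('v::linorder, 'k::field) mpoly"
  assumes "p \<in> polys_in V" "i \<notin> V" "l \<in> polys_in V" "deg_less i n r"
    and dvd: "p dvd l * xpow i n + r" and nz: "p \<noteq> 0"
  shows "p dvd l"
proof (cases "l = 0")
  case False
  define M where "M = {m :: 'v \<Rightarrow>\<^sub>0 nat. lookup m i = n}"
  from dvd obtain z where z: "l * xpow i n + r = p * z" by (rule dvdE)
  have "restr M (l * xpow i n) = l * xpow i n"
    using lookup_polys_in[OF \<open>l \<in> polys_in V\<close> _ \<open>i \<notin> V\<close>]
    by (auto simp: restr_id_iff M_def lookup_add elim!: in_keys_multE)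
  moreover have "restr M r = 0"
    using \<open>deg_less i n r\<close> by (auto simp: restr_eq_0_iff M_def deg_less_def)
  moreover have "restr M (p * z) = p * restr M z"
    using lookup_polys_in[OF \<open>p \<in> polys_in V\<close> _ \<open>i \<notin> V\<close>] by (intro restr_mult) (auto simp: M_def lookup_add)
  ultimately have eq: "l * xpow i n = p * restr M z"
    using z by (metis restr_add add.right_neutral)
  have "l * xpow i n \<in> polys_in (insert i V)"
    using \<open>l \<in> polys_in V\<close> by (intro polys_in_mult xpow_in_polys_in) (auto intro: polys_in_mono)
  moreover have "l * xpow i n \<noteq> 0" using False by simp
  ultimately have "restr M z \<in> polys_in (insert i V)"
    using eq polys_in_factor(2) by metis
  then obtain l' where "restr M z = l' * xpow i n"
    by (rule factor_xpow[where e = n]) (auto simp: keys_restr M_def)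
  hence "l * xpow i n = (p * l') * xpow i n"
    using eq by (simp add: mult.assoc)
  hence "l = p * l'"
    by (simp only: mult_cancel_right xpow_nonzero simp_thms)
  thus ?thesis by simp
qed simp

text \<open>
  The familiar fact that a prime of a ring stays prime in the polynomial ring over it: a prime that
  divides \<open>g h\<close> divides the product of the leading coefficients, hence one of them, and that leading
  term can be split off.
\<close>
lemma irreducible_coeff_prime:
  fixes p g h :: "('v::linorder, 'k::field) mpoly"
  assumes IH: "irreducibles_prime V TYPE('k)" and "i \<notin> V"
    and p: "p \<in> polys_in V" "Factorial_Ring.irreducible p"
    and "g \<in> polys_in (insert i V)" "h \<in> polys_in (insert i V)" "p dvd g * h"
  shows "p dvd g \<or> p dvd h"
proof -
  have nz: "p \<noteq> 0" using p by auto
  have "p dvd g \<or> p dvd h"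
    if "deg_less i a g" "deg_less i b h" "g \<in> polys_in (insert i V)" "h \<in> polys_in (insert i V)"
       "p dvd g * h" for a b g h
    using that
  proof (induction "a + b" arbitrary: a b g h rule: less_induct)
    case less
    show ?case
    proof (cases "a = 0 \<or> b = 0")
      case True
      thus ?thesis using less.prems by auto
    next
      case False
      then obtain a' b' where ab: "a = Suc a'" "b = Suc b'"
        by (metis not0_implies_Suc)
      obtain l r where g: "l \<in> polys_in V" "r \<in> polys_in (insert i V)" "deg_less i a' r"
        "g = l * xpow i a' + r"
        using less.prems ab by (metis leading_coeff_split)
      obtain l' r' where h: "l' \<in> polys_in V" "r' \<in> polys_in (insert i V)" "deg_less i b' r'"
        "h = l' * xpow i b' + r'"
        using less.prems ab by (metis leading_coeff_split)
      have "deg_less i (Suc a') (l * xpow i a')"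
        using deg_less_mult[OF deg_less_polys_in[OF g(1) \<open>i \<notin> V\<close>] deg_less_xpow[of i a']] by simp
      hence "deg_less i (a' + b') (l * xpow i a' * r')"
        using h(3) by (rule deg_less_mult)
      moreover have "deg_less i (b' + a') (h * r)"
        using less.prems(2) g(3) unfolding ab by (rule deg_less_mult)
      ultimately have "deg_less i (a' + b') (l * xpow i a' * r' + r * h)"
        by (intro deg_less_add) (simp_all only: mult.commute[of r h] add.commute[of a' b'])
      moreover have "g * h = (l * l') * xpow i (a' + b') + (l * xpow i a' * r' + r * h)"
        unfolding xpow_add by (simp add: g h algebra_simps)
      ultimately have "p dvd l * l'"
        using dvd_leading_coeff[OF p(1) \<open>i \<notin> V\<close> polys_in_mult[OF g(1) h(1)]] less.prems(5) nz by metis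
      hence "p dvd l \<or> p dvd l'"
        using irreducibles_primeD[OF IH p(2)] p(1) g h by blast
      thus ?thesis
      proof
        assume l: "p dvd l"
        have "p dvd g * h - (l * xpow i a') * h"
          using l less.prems(5) by (intro dvd_diff) auto
        hence "p dvd r * h" by (simp add: g(4) algebra_simps)
        hence "p dvd r \<or> p dvd h"
          using less.hyps[of a' b r h] less.prems g ab by simp
        thus ?thesis using l g(4) by auto
      next
        assume l: "p dvd l'"
        have "p dvd g * h - g * (l' * xpow i b')"
          using l less.prems(5) by (intro dvd_diff) auto
        hence "p dvd g * r'" by (simp add: h(4) algebra_simps)
        hence "p dvd g \<or> p dvd r'"
          using less.hyps[of a b' g r'] less.prems h ab by simp
        thus ?thesis using l h(4) by auto
      qed
    qed
  qed
  thus ?thesis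
    using assms ex_deg_less[of i g] ex_deg_less[of i h] by blast
qed

text \<open>
  This takes the place of Gauss's lemma: a factorisation of \<open>f\<close> with a denominator \<open>c\<close> from the
  coefficient ring can be turned into one without. The irreducible factors of \<open>c\<close> are prime, so each
  of them can be cancelled from one of the two factors.
\<close>
lemma clear_denominator:
  fixes c f q u :: "('v::linorder, 'k::field) mpoly"
  assumes IH: "irreducibles_prime V TYPE('k)" and "i \<notin> V"
    and c: "c \<noteq> 0" "c \<in> polys_in V"
    and "q \<in> polys_in (insert i V)" "u \<in> polys_in (insert i V)" "c * f = q * u" "f \<noteq> 0"
  obtains c1 c2 q' u' where "c1 \<in> polys_in V" "c2 \<in> polys_in V" "q = c1 * q'" "u = c2 * u'"
    "f = q' * u'"
proof -
  have "\<exists>c1 c2 q' u'. c1 \<in> polys_in V \<and> c2 \<in> polys_in V \<and> q = c1 * q' \<and> u = c2 * u' \<and> f = q' * u'"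
    using assms(3-7)
  proof (induction c arbitrary: q u rule: factorisation_induct)
    case (unit c)
    then obtain d where d: "1 = c * d" by blast
    have "q = c * (d * q)" by (simp add: d[symmetric] mult.assoc[symmetric])
    moreover have "f = d * (c * f)"
      using d by (metis mult.assoc mult.commute mult_1)
    hence "f = (d * q) * u" using unit by (simp add: mult.assoc)
    ultimately show ?case
      by (metis unit.prems(1) polys_in_1 mult_1)
  next
    case (mult p c)
    have nz: "p \<noteq> 0" "q \<noteq> 0" "u \<noteq> 0" using mult \<open>f \<noteq> 0\<close> by auto
    have "p \<in> polys_in V" "c \<in> polys_in V"
      using mult nz by (metis polys_in_factor no_zero_divisors)+
    moreover have "p dvd q * u"
      using mult by (metis dvd_triv_left mult.assoc)
    ultimately have "p dvd q \<or> p dvd u"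
      using irreducible_coeff_prime[OF IH \<open>i \<notin> V\<close>] mult by blast
    thus ?case
    proof
      assume "p dvd q"
      then obtain q0 where q0: "q = p * q0" by blast
      hence "c * f = q0 * u" using mult nz by (simp add: mult.assoc)
      moreover have "q0 \<in> polys_in (insert i V)" using mult.prems q0 nz by (metis polys_in_factor(2))
      ultimately obtain c1 c2 q' u' where "c1 \<in> polys_in V" "c2 \<in> polys_in V" "q0 = c1 * q'"
        "u = c2 * u'" "f = q' * u'"
        using mult.IH[of q0 u] \<open>c \<in> polys_in V\<close> mult.prems by blast
      moreover from this have "q = (p * c1) * q'" "p * c1 \<in> polys_in V"
        using q0 \<open>p \<in> polys_in V\<close> by (simp_all add: mult.assoc polys_in_mult)
      ultimately show ?thesis by blast
    next
      assume "p dvd u"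
      then obtain u0 where u0: "u = p * u0" by blast
      hence "c * f = q * u0" using mult nz by (simp add: mult.assoc mult.left_commute)
      moreover have "u0 \<in> polys_in (insert i V)" using mult.prems u0 nz by (metis polys_in_factor(2))
      ultimately obtain c1 c2 q' u' where "c1 \<in> polys_in V" "c2 \<in> polys_in V" "q = c1 * q'"
        "u0 = c2 * u'" "f = q' * u'"
        using mult.IH[of q u0] \<open>c \<in> polys_in V\<close> mult.prems by blast
      moreover from this have "u = (p * c2) * u'" "p * c2 \<in> polys_in V"
        using u0 \<open>p \<in> polys_in V\<close> by (simp_all add: mult.assoc polys_in_mult)
      ultimately show ?thesis by blast
    qed
  qed
  thus ?thesis using that by blast
qed

text \<open>
  Among the \<open>w\<close> with \<open>f dvd w * h\<close>, which form an ideal, let \<open>u\<close> be nonzero and of least degree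
  in \<open>i\<close>. Pseudo-division by \<open>u\<close> stays in that ideal, so by minimality the remainder is zero.
  Thus \<open>u\<close> generates the ideal up to denominators \<open>c\<close> in which \<open>i\<close> does not occur.
\<close>
lemma pseudo_divide:
  fixes u v h f :: "('v::linorder, 'k::field) mpoly"
  assumes "i \<notin> V" and u: "u \<noteq> 0" "u \<in> polys_in (insert i V)" "f dvd u * h"
    and min: "\<And>w. w \<noteq> 0 \<Longrightarrow> w \<in> polys_in (insert i V) \<Longrightarrow> f dvd w * h \<Longrightarrow>
                wdeg (\<lambda>m. lookup m i) u \<le> wdeg (\<lambda>m. lookup m i) w"
    and v: "v \<in> polys_in (insert i V)" "f dvd v * h"
  obtains c q where "c \<noteq> 0" "c \<in> polys_in V" "q \<in> polys_in (insert i V)" "c * v = q * u"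
proof -
  define d where "d = wdeg (\<lambda>m. lookup m i) u"
  have "deg_less i (Suc d) u" using u(1) by (simp add: deg_less_wdeg d_def)
  then obtain lu ru where lu: "lu \<in> polys_in V" "ru \<in> polys_in (insert i V)" "deg_less i d ru"
    "u = lu * xpow i d + ru"
    using u(2) leading_coeff_split by metis
  have "lu \<noteq> 0"
  proof
    assume "lu = 0"
    hence "deg_less i d u" using lu by simp
    thus False using u(1) by (simp add: deg_less_wdeg d_def)
  qed
  have sub: "q \<in> polys_in V \<Longrightarrow> q \<in> polys_in (insert i V)" for q :: "('v, 'k) mpoly"
    by (rule polys_in_mono) auto
  have "\<exists>c q. c \<noteq> 0 \<and> c \<in> polys_in V \<and> q \<in> polys_in (insert i V) \<and> c * v = q * u"
    if "deg_less i n v" "v \<in> polys_in (insert i V)" "f dvd v * h" for n v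
    using that
  proof (induction n arbitrary: v)
    case 0
    thus ?case by (intro exI[of _ 1] exI[of _ 0]) auto
  next
    case (Suc n)
    show ?case
    proof (cases "n < d")
      case True
      \<comment> \<open>A nonzero \<open>v\<close> would have smaller degree in \<open>i\<close> than \<open>u\<close>.\<close>
      hence "v = 0"
        using min[OF _ Suc.prems(2,3)] Suc.prems(1) deg_less_wdeg[of v i "Suc n"]
        unfolding d_def by linarith
      thus ?thesis by (intro exI[of _ 1] exI[of _ 0]) auto
    next
      case False
      obtain l r where l: "l \<in> polys_in V" "r \<in> polys_in (insert i V)" "deg_less i n r"
        "v = l * xpow i n + r"
        using Suc.prems leading_coeff_split by metis
      \<comment> \<open>In \<open>lu * v - s * u\<close> the leading terms cancel.\<close>
      define s where "s = l * xpow i (n - d)"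
      have s: "s \<in> polys_in (insert i V)"
        unfolding s_def using l(1) by (intro polys_in_mult xpow_in_polys_in sub) auto
      have "deg_less i (0 + Suc (n - d)) s"
        unfolding s_def
        by (rule deg_less_mult[OF deg_less_polys_in[OF l(1) \<open>i \<notin> V\<close>] deg_less_xpow])
      hence "deg_less i (n - d + d) (s * ru)"
        using lu(3) by (intro deg_less_mult) auto
      moreover have "deg_less i (0 + n) (lu * r)"
        by (rule deg_less_mult[OF deg_less_polys_in[OF lu(1) \<open>i \<notin> V\<close>] l(3)])
      moreover have "lu * v - s * u = lu * r - s * ru"
      proof -
        have "xpow i n = xpow i (n - d) * (xpow i d :: ('v, 'k) mpoly)"
          using False xpow_add[of i "n - d" d] by simp
        hence eq: "s * (lu * xpow i d) = lu * (l * xpow i n)"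
          by (simp only: s_def mult_ac)
        show ?thesis by (simp only: l(4) lu(4) distrib_left eq add_diff_cancel_left)
      qed
      ultimately have "deg_less i n (lu * v - s * u)"
        using False by (auto intro: deg_less_diff)
      moreover have "lu * v - s * u \<in> polys_in (insert i V)"
        using sub lu(1) s u(2) Suc.prems by (intro polys_in_diff polys_in_mult) auto
      moreover have "f dvd (lu * v - s * u) * h"
        using Suc.prems(3) u(3) by (auto simp: left_diff_distrib mult.assoc intro!: dvd_diff)
      ultimately obtain c q where cq: "c \<noteq> 0" "c \<in> polys_in V" "q \<in> polys_in (insert i V)"
        "c * (lu * v - s * u) = q * u"
        using Suc.IH by blast
      have "(c * lu) * v = (q + c * s) * u"
        using cq(4) by (simp add: algebra_simps)
      moreover have "c * lu \<noteq> 0" "c * lu \<in> polys_in V" "q + c * s \<in> polys_in (insert i V)"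
        using cq lu(1) \<open>lu \<noteq> 0\<close> s sub by (auto intro!: polys_in_mult polys_in_add)
      ultimately show ?thesis by blast
    qed
  qed
  thus ?thesis
    using v that ex_deg_less[of i v] by blast
qed

text \<open>
  Let \<open>f\<close> be irreducible and divide \<open>g h\<close>. The polynomials \<open>w\<close> with \<open>f dvd w * h\<close> include \<open>f\<close>
  and \<open>g\<close>. Let \<open>u\<close> be a nonzero one of least degree in \<open>i\<close>. Then \<open>f\<close> is, up to a denominator, a multiple of
  \<open>u\<close>, and since \<open>f\<close> is irreducible, \<open>u\<close> is up to a factor from the coefficient ring either
  associated to \<open>f\<close> or a unit. In the first case \<open>g\<close>, being a multiple of \<open>u\<close> up to a
  denominator, is divisible by \<open>f\<close>; in the second case \<open>f\<close> divides \<open>h\<close> up to a denominator.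
  Denominators can be cancelled because \<open>f\<close> involves \<open>i\<close> and therefore has no nonunit factor in
  the coefficient ring.
\<close>
lemma irreducibles_prime_insert:
  assumes IH: "irreducibles_prime V TYPE('k::field)" and "i \<notin> V"
  shows "irreducibles_prime (insert i V) TYPE('k)"
  unfolding irreducibles_prime_def
proof (intro allI impI)
  fix f g h :: "('a, 'k) mpoly"
  assume f: "f \<in> polys_in (insert i V)" "Factorial_Ring.irreducible f"
    and g: "g \<in> polys_in (insert i V)" and h: "h \<in> polys_in (insert i V)" and dvd: "f dvd g * h"
  have fnz: "f \<noteq> 0" using f by auto
  show "f dvd g \<or> f dvd h"
  proof (cases "f \<in> polys_in V \<or> g = 0 \<or> h = 0")
    case True
    thus ?thesis using irreducible_coeff_prime[OF IH \<open>i \<notin> V\<close>] f g h dvd by auto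
  next
    case False
    have cancel: "f dvd v"
      if v: "c \<noteq> 0" "c \<in> polys_in V" "v \<in> polys_in (insert i V)" "c * v = f * w" "v \<noteq> 0" for c v w
    proof -
      have "c \<in> polys_in (insert i V)"
        using v(2) by (rule polys_in_mono[rotated]) auto
      hence "f * w \<in> polys_in (insert i V)" "f * w \<noteq> 0"
        using v polys_in_mult[of c _ v] no_zero_divisors[of c v] by simp_all
      hence "w \<in> polys_in (insert i V)"
        by (rule polys_in_factor(2))
      then obtain c1 c2 f' w' where *: "c1 \<in> polys_in V" "f = c1 * f'" "v = f' * w'"
        using clear_denominator[OF IH \<open>i \<notin> V\<close> v(1,2) f(1) _ v(4,5)] by metis
      \<comment> \<open>Otherwise irreducibility makes the cofactor \<open>f'\<close> a unit, and \<open>f\<close> does not involve \<open>i\<close>.\<close>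
      have "c1 dvd 1"
      proof (rule ccontr)
        assume "\<not> c1 dvd 1"
        hence "f' dvd 1" using Factorial_Ring.irreducibleD[OF f(2) *(2)] by simp
        hence "f \<in> polys_in V" using * by (metis is_unit_polys_in polys_in_mult)
        thus False using False by simp
      qed
      hence "f dvd f'" using mult_dvd_mono[of c1 1 f' f'] *(2) by simp
      thus ?thesis using *(3) by auto
    qed
    define I where "I = {u \<in> polys_in (insert i V). u \<noteq> 0 \<and> f dvd u * h}"
    define u where "u = arg_min (wdeg (\<lambda>m. lookup m i)) (\<lambda>u. u \<in> I)"
    have "f \<in> I" using f fnz by (auto simp: I_def)
    hence "u \<in> I" unfolding u_def by (rule arg_min_natI)
    hence u: "u \<noteq> 0" "u \<in> polys_in (insert i V)" "f dvd u * h" by (auto simp: I_def)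
    have umin: "wdeg (\<lambda>m. lookup m i) u \<le> wdeg (\<lambda>m. lookup m i) w"
      if "w \<noteq> 0" "w \<in> polys_in (insert i V)" "f dvd w * h" for w
      unfolding u_def using that by (intro arg_min_nat_le) (auto simp: I_def)
    obtain c q where c: "c \<noteq> 0" "c \<in> polys_in V" "q \<in> polys_in (insert i V)" "c * f = q * u"
      using pseudo_divide[OF \<open>i \<notin> V\<close> u umin f(1) dvd_triv_left] .
    obtain c' q'' where c': "c' \<noteq> 0" "c' \<in> polys_in V" "c' * g = q'' * u"
      using pseudo_divide[OF \<open>i \<notin> V\<close> u umin g dvd] .
    obtain c1 c2 q' u' where split: "c2 \<in> polys_in V" "u = c2 * u'" "f = q' * u'"
      using clear_denominator[OF IH \<open>i \<notin> V\<close> c(1,2,3) u(2) c(4) fnz] by metis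
    have "q' dvd 1 \<or> u' dvd 1"
      using Factorial_Ring.irreducibleD[OF f(2) split(3)] .
    thus ?thesis
    proof
      assume q': "q' dvd 1"
      have "c' * (q' * g) = f * (q'' * c2)"
        using c'(3) split by (simp add: mult_ac)
      moreover have "q' * g \<in> polys_in (insert i V)" "q' * g \<noteq> 0"
        using q' g False by (auto intro: polys_in_mult is_unit_polys_in)
      ultimately have "f dvd q' * g" using cancel c' by blast
      moreover have "q' * g dvd g"
        using mult_dvd_mono[OF q' dvd_refl[of g]] by simp
      ultimately show ?thesis using dvd_trans by blast
    next
      assume u': "u' dvd 1"
      have "u * h dvd c2 * h"
        unfolding split(2)
        using mult_dvd_mono[OF mult_dvd_mono[OF dvd_refl[of c2] u'] dvd_refl[of h]] by simp
      hence "f dvd c2 * h" using u(3) dvd_trans by blast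
      then obtain w where "c2 * h = f * w" by blast
      moreover have "c2 \<noteq> 0" using split u by auto
      ultimately show ?thesis using cancel split(1) h False by blast
    qed
  qed
qed

theorem irreducible_imp_prime_elem:
  fixes p :: "('v::linorder, 'k::field) mpoly"
  assumes "Factorial_Ring.irreducible p"
  shows "Factorial_Ring.prime_elem p"
proof (rule prime_elemI)
  show "p \<noteq> 0" "\<not> p dvd 1" using assms by (auto simp: irreducible_not_unit)
  fix g h assume dvd: "p dvd g * h"
  have fin: "irreducibles_prime V TYPE('k)" if "finite V" for V :: "'v set"
    using that
  proof induction
    case empty
    have "p dvd 1" if "p \<in> polys_in {}" "p \<noteq> 0" for p :: "('v, 'k) mpoly"
    proof -
      obtain m where "m \<in> keys p" "mdeg m = tdeg p"
        using \<open>p \<noteq> 0\<close> by (rule wdeg_attained)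
      moreover from this have "m = 0"
        using \<open>p \<in> polys_in {}\<close> by (auto simp: polys_in_def)
      ultimately show ?thesis using \<open>p \<noteq> 0\<close> by (simp add: is_unit_iff_tdeg)
    qed
    thus ?case unfolding irreducibles_prime_def
      using irreducible_not_unit by (metis not_irreducible_zero)
  next
    case (insert i V)
    thus ?case by (intro irreducibles_prime_insert)
  qed
  define V where "V = (\<Union>m\<in>keys p \<union> keys g \<union> keys h. keys m)"
  have "finite V" "p \<in> polys_in V" "g \<in> polys_in V" "h \<in> polys_in V"
    by (auto simp: V_def polys_in_def)
  thus "p dvd g \<or> p dvd h"
    using irreducibles_primeD[OF fin assms dvd] by blast
qed

section \<open>Least common multiples\<close>

text \<open>
  Take a prime \<open>p\<close> out of \<open>p * b\<close>. If \<open>p\<close> divides \<open>a\<close>, it can be taken out of everything. If not,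
  then a multiple \<open>p * y\<close> of \<open>a\<close> has \<open>a dvd y\<close>, so the least common multiple of \<open>a\<close> and \<open>p * b\<close> is
  \<open>p\<close> times that of \<open>a\<close> and \<open>b\<close>.
\<close>
lemma ex_lcm2:
  fixes a b :: "('v::linorder, 'k::field) mpoly"
  assumes "a \<noteq> 0" "b \<noteq> 0"
  obtains L where "L \<noteq> 0" "\<And>x. a dvd x \<and> b dvd x \<longleftrightarrow> L dvd x"
proof -
  have "\<exists>L. L \<noteq> 0 \<and> (\<forall>x. a dvd x \<and> b dvd x \<longleftrightarrow> L dvd x)"
    using \<open>b \<noteq> 0\<close> \<open>a \<noteq> 0\<close>
  proof (induction b arbitrary: a rule: factorisation_induct)
    case (unit u)
    hence "u dvd x" for x by (metis dvd_trans one_dvd)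
    thus ?case using unit by auto
  next
    case (mult p b)
    have p: "p \<noteq> 0" "Factorial_Ring.prime_elem p"
      using mult by (auto intro: irreducible_imp_prime_elem)
    show ?case
    proof (cases "p dvd a")
      case True
      then obtain a' where a': "a = p * a'" by blast
      then obtain L where L: "L \<noteq> 0" "\<And>x. a' dvd x \<and> b dvd x \<longleftrightarrow> L dvd x"
        using mult.IH[of a'] mult.prems by auto
      have "a dvd x \<and> p * b dvd x \<longleftrightarrow> p * L dvd x" for x
      proof (cases "p dvd x")
        case True
        then obtain y where "x = p * y" by blast
        thus ?thesis using L(2)[of y] p(1) by (simp add: a')
      next
        case False
        thus ?thesis unfolding a' by (metis dvd_mult_left)
      qed
      thus ?thesis using L(1) p(1) by (intro exI[of _ "p * L"]) auto
    next
      case False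
      obtain L where L: "L \<noteq> 0" "\<And>x. a dvd x \<and> b dvd x \<longleftrightarrow> L dvd x"
        using mult.IH[of a] mult.prems by auto
      have "a dvd x \<and> p * b dvd x \<longleftrightarrow> p * L dvd x" for x
      proof (cases "p dvd x")
        case True
        then obtain y where y: "x = p * y" by blast
        have "a dvd y" if "a dvd p * y"
        proof -
          from that obtain z where z: "p * y = a * z" by blast
          hence "p dvd a * z" by (metis dvd_triv_left)
          hence "p dvd z" using False p(2) prime_elem_dvd_multD by blast
          then obtain z' where "z = p * z'" by blast
          hence "p * y = p * (a * z')" using z by (simp only: mult_ac)
          thus ?thesis using p(1) by simp
        qed
        hence "a dvd p * y \<longleftrightarrow> a dvd y" by auto
        thus ?thesis using L(2)[of y] p(1) by (simp add: y)
      next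
        case False
        thus ?thesis by (metis dvd_mult_left)
      qed
      thus ?thesis using L(1) p(1) by (intro exI[of _ "p * L"]) auto
    qed
  qed
  thus ?thesis using that by blast
qed

lemma ex_lcm:
  fixes A :: "('v::linorder, 'k::field) mpoly set"
  assumes "finite A" "0 \<notin> A"
  obtains L where "L \<noteq> 0" "\<And>x. (\<forall>a\<in>A. a dvd x) \<longleftrightarrow> L dvd x"
proof -
  have "\<exists>L. L \<noteq> 0 \<and> (\<forall>x. (\<forall>a\<in>A. a dvd x) \<longleftrightarrow> L dvd x)"
    using assms
  proof induction
    case empty
    thus ?case by (intro exI[of _ 1]) auto
  next
    case (insert a A)
    then obtain L where L: "L \<noteq> 0" "\<And>x. (\<forall>a\<in>A. a dvd x) \<longleftrightarrow> L dvd x" by auto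
    obtain L' where "L' \<noteq> 0" "\<And>x. a dvd x \<and> L dvd x \<longleftrightarrow> L' dvd x"
      using ex_lcm2[of a L] insert L(1) by auto
    thus ?case using L(2) by auto
  qed
  thus ?thesis using that by blast
qed

section \<open>Parity\<close>

definition evens :: "('v, 'k::zero) mpoly set" where
  "evens = {p. \<forall>m\<in>keys p. even (mdeg m)}"

definition odds :: "('v, 'k::zero) mpoly set" where
  "odds = {p. \<forall>m\<in>keys p. odd (mdeg m)}"

definition odd_part :: "('v, 'k::zero) mpoly \<Rightarrow> ('v, 'k) mpoly" where
  "odd_part p = restr {m. odd (mdeg m)} p"

lemma odd_part_eq_0_iff: "odd_part p = 0 \<longleftrightarrow> p \<in> evens"
  by (auto simp: odd_part_def restr_eq_0_iff evens_def)

lemma odd_part_eq_self_iff: "odd_part p = p \<longleftrightarrow> p \<in> odds"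
  by (auto simp: odd_part_def restr_id_iff odds_def)

lemma odd_part_odds: "odd_part p \<in> odds"
  by (auto simp: odd_part_def keys_restr odds_def)

lemma odd_part_mult:
  fixes a q :: "('v, 'k::semiring_0) mpoly"
  shows "a \<in> evens \<Longrightarrow> odd_part (a * q) = a * odd_part q"
  unfolding odd_part_def by (rule restr_mult) (auto simp: evens_def mdeg_add)

lemma evens_mult:
  fixes p q :: "('v, 'k::semiring_0) mpoly"
  shows "p \<in> evens \<Longrightarrow> q \<in> evens \<Longrightarrow> p * q \<in> evens"
  by (simp flip: odd_part_eq_0_iff add: odd_part_mult)

lemma odds_mult:
  fixes p q :: "('v, 'k::semiring_0) mpoly"
  shows "p \<in> odds \<Longrightarrow> q \<in> odds \<Longrightarrow> p * q \<in> evens"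
  by (auto simp: odds_def evens_def mdeg_add elim!: in_keys_multE)

lemma evens_odds_mult:
  fixes p q :: "('v, 'k::semiring_0) mpoly"
  shows "p \<in> evens \<Longrightarrow> q \<in> odds \<Longrightarrow> p * q \<in> odds"
  by (simp flip: odd_part_eq_self_iff add: odd_part_mult)

lemma evens_add: "p \<in> evens \<Longrightarrow> q \<in> evens \<Longrightarrow> p + q \<in> evens"
  by (simp flip: odd_part_eq_0_iff add: odd_part_def restr_add)

lemma odds_add: "p \<in> odds \<Longrightarrow> q \<in> odds \<Longrightarrow> p + q \<in> odds"
  by (simp flip: odd_part_eq_self_iff add: odd_part_def restr_add)

lemma evens_uminus: 
  fixes p :: "('v, 'k::ab_group_add) mpoly"
  shows "p \<in> evens \<Longrightarrow> - p \<in> evens"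
  by (simp add: evens_def in_keys_iff)

lemma evens_0 [simp]: "0 \<in> evens" and odds_0 [simp]: "0 \<in> odds"
  by (simp_all add: evens_def odds_def)

lemma evens_1 [simp]: "(1 :: ('v, 'k::zero_neq_one) mpoly) \<in> evens"
  by (simp add: evens_def)

lemma evens_factor:
  fixes a q :: "('v::linorder, 'k::idom) mpoly"
  assumes "a * q \<in> evens" "a \<in> evens" "a \<noteq> 0"
  shows "q \<in> evens"
  using assms by (simp flip: odd_part_eq_0_iff add: odd_part_mult)

text \<open>
  Multiplying by \<open>a\<close> once more reduces this to multiplication by the even polynomial \<open>a * a\<close>.
\<close>
lemma odds_factor:
  fixes a q :: "('v::linorder, 'k::idom) mpoly"
  assumes "a * q \<in> evens" "a \<in> odds" "a \<noteq> 0"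
  shows "q \<in> odds"
proof -
  have "q * (a * a) \<in> odds"
    using evens_odds_mult[OF assms(1,2)] by (simp add: mult_ac)
  hence "odd_part ((a * a) * q) = (a * a) * q"
    by (simp only: odd_part_eq_self_iff mult.commute)
  hence "(a * a) * odd_part q = (a * a) * q"
    by (simp only: odd_part_mult[OF odds_mult[OF assms(2) assms(2)]])
  hence "odd_part q = q" using assms(3) by simp
  thus ?thesis by (simp only: odd_part_eq_self_iff)
qed

text \<open>
  The parity grading is used in place of the substitution of \<open>- v\<close> for each indeterminate \<open>v\<close>,
  which is trivial in characteristic 2. Every element of \<open>A\<close> divides the odd part of \<open>L\<close>, so \<open>L\<close>
  divides it as well, and the quotient must be a constant.
\<close>
lemma lcm_homogeneous:
  fixes L :: "('v::linorder, 'k::field) mpoly"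
  assumes "A \<subseteq> evens" "L \<noteq> 0" and lcm: "\<And>x. (\<forall>a\<in>A. a dvd x) \<longleftrightarrow> L dvd x"
  shows "L \<in> evens \<or> L \<in> odds"
proof (cases "odd_part L = 0")
  case True
  thus ?thesis by (simp add: odd_part_eq_0_iff)
next
  case False
  have "a dvd odd_part L" if "a \<in> A" for a
  proof -
    have "a dvd L" using that lcm[of L] by simp
    then obtain q where "L = a * q" by blast
    thus ?thesis using odd_part_mult[of a q] that assms(1) by auto
  qed
  hence "L dvd odd_part L" using lcm[of "odd_part L"] by blast
  then obtain c where c: "odd_part L = c * L"
    unfolding dvd_def mult.commute[of L] by blast
  hence cnz: "c \<noteq> 0" using False by auto
  obtain m where "m \<in> keys (odd_part L)" "mdeg m = tdeg (odd_part L)"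
    using False by (rule wdeg_attained)
  hence "tdeg (odd_part L) \<le> tdeg L"
    using le_wdeg[of m L mdeg] by (simp add: odd_part_def keys_restr)
  hence "tdeg c = 0"
    using c cnz assms(2) by (simp add: tdeg_mult)
  hence "keys c \<subseteq> {0}"
    using cnz by (intro keys_unit) (simp add: is_unit_iff_tdeg)
  hence "c \<in> evens" by (auto simp: evens_def)
  have "c * odd_part L = odd_part (odd_part L)"
    unfolding c by (simp only: odd_part_mult[OF \<open>c \<in> evens\<close>] c)
  also have "\<dots> = odd_part L"
    using odd_part_odds by (simp add: odd_part_eq_self_iff)
  finally have "odd_part L = L" using c cnz by simp
  thus ?thesis by (simp add: odd_part_eq_self_iff)
qed

section \<open>The ring of even polynomials\<close>

text \<open>
  A monomial of even positive degree contains two indeterminates, possibly equal, whose product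
  can be split off.
\<close>
lemma even_single_in_generate_ring:
  fixes c :: "'k::field"
  assumes "even (mdeg m)"
  shows "single m c \<in> generate_ring ring_of_type_algebra
           (Set.range const_inf \<union> {indet i * indet j | i j. True})" (is "_ \<in> ?G")
  using assms
proof (induction "mdeg m" arbitrary: m rule: less_induct)
  case less
  have mult: "p * q \<in> ?G" if "p \<in> ?G" "q \<in> ?G" for p q
    using generate_ring.eng_mult[OF that] by (simp add: ring_of_type_algebra_def)
  show ?case
  proof (cases "m = 0")
    case True
    thus ?thesis by (auto intro!: generate_ring.incl simp: const_inf_def)
  next
    case False
    have split: "\<exists>i m'. m = m' + single i 1" if "m \<noteq> 0" for m :: "nat \<Rightarrow>\<^sub>0 nat"
    proof -
      from keys_nonempty[OF that] obtain i where "i \<in> keys m" by blast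
      hence "m = (m - single i 1) + single i 1"
        by (intro poly_mapping_eqI) (auto simp: lookup_add lookup_minus lookup_single when_def in_keys_iff)
      thus ?thesis by blast
    qed
    obtain i m1 where m1: "m = m1 + single i 1" using split[OF False] by blast
    hence "odd (mdeg m1)" using less.prems by (simp add: mdeg_add)
    hence "m1 \<noteq> 0" by auto
    then obtain j m2 where m2: "m1 = m2 + single j 1" using split by blast
    have "single m2 c \<in> ?G"
      using less m1 m2 by (auto simp: mdeg_add)
    moreover have "indet i * indet j \<in> ?G" by (rule generate_ring.incl) auto
    moreover have "single m c = single m2 c * (indet i * indet j)"
      by (simp add: m1 m2 indet_def mult_single add_ac)
    ultimately show ?thesis using mult by simp
  qed
qed

lemma carrier_quadratic_subalgebra:
  "carrier (quadratic_subalgebra :: 'k::field poly_inf ring) = evens"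
proof -
  let ?G = "generate_ring ring_of_type_algebra
           (Set.range const_inf \<union> {indet i * indet j | i j. True}) :: 'k poly_inf set"
  interpret T: ring "ring_of_type_algebra :: 'k poly_inf ring" by (rule ring_from_type_algebra)
  have uminus: "\<ominus>\<^bsub>ring_of_type_algebra\<^esub> p = - p" for p :: "'k poly_inf"
    by (rule T.minus_equality) (auto simp: ring_of_type_algebra_def)
  have "p \<in> evens" if "p \<in> ?G" for p
    using that
  proof induction
    case (incl h)
    thus ?case
      by (auto simp: const_inf_def indet_def evens_def mult_single mdeg_add split: if_splits)
  next
    case (a_inv h)
    thus ?case by (simp only: uminus evens_uminus)
  qed (auto simp: ring_of_type_algebra_def evens_add evens_mult)
  moreover have "p \<in> ?G" if "p \<in> evens" for p
  proof -
    have sums: "(\<Sum>m\<in>M. single m (lookup p m)) \<in> ?G" if "finite M" "M \<subseteq> keys p" for M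
      using that
    proof induction
      case empty
      have "single 0 0 \<in> ?G" by (rule even_single_in_generate_ring) simp
      thus ?case by simp
    next
      case (insert m M)
      hence "single m (lookup p m) \<in> ?G"
        using \<open>p \<in> evens\<close> by (intro even_single_in_generate_ring) (auto simp: evens_def)
      thus ?case
        using insert generate_ring.eng_add by (fastforce simp: ring_of_type_algebra_def)
    qed
    have eq: "p = (\<Sum>m\<in>keys p. single m (lookup p m))"
      by (rule poly_mapping_eqI) (auto simp: lookup_sum lookup_single when_def in_keys_iff)
    show ?thesis by (subst eq, rule sums) auto
  qed
  ultimately show ?thesis by (auto simp: quadratic_subalgebra_def)
qed

lemma quadratic_subalgebra_simps [simp]:
  fixes x y :: "'k::field poly_inf"
  shows "x \<otimes>\<^bsub>quadratic_subalgebra\<^esub> y = x * y" "x \<oplus>\<^bsub>quadratic_subalgebra\<^esub> y = x + y"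
    "\<one>\<^bsub>quadratic_subalgebra\<^esub> = (1 :: 'k poly_inf)" "\<zero>\<^bsub>quadratic_subalgebra\<^esub> = (0 :: 'k poly_inf)"
  by (simp_all add: quadratic_subalgebra_def ring_of_type_algebra_def)

lemma domain_quadratic_subalgebra: "domain (quadratic_subalgebra :: 'k::field poly_inf ring)"
proof (rule domain.intro)
  show "cring (quadratic_subalgebra :: 'k poly_inf ring)"
  proof (rule cringI)
    show "abelian_group (quadratic_subalgebra :: 'k poly_inf ring)"
    proof (rule abelian_groupI)
      fix p :: "'k poly_inf" assume "p \<in> carrier quadratic_subalgebra"
      thus "\<exists>y\<in>carrier quadratic_subalgebra. y \<oplus>\<^bsub>quadratic_subalgebra\<^esub> p = \<zero>\<^bsub>quadratic_subalgebra\<^esub>"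
        by (intro bexI[of _ "- p"]) (auto simp: carrier_quadratic_subalgebra evens_uminus)
    qed (auto simp: carrier_quadratic_subalgebra evens_add algebra_simps)
    show "Group.comm_monoid (quadratic_subalgebra :: 'k poly_inf ring)"
      by (rule comm_monoidI) (auto simp: carrier_quadratic_subalgebra evens_mult algebra_simps)
  qed (auto simp: algebra_simps)
  show "domain_axioms (quadratic_subalgebra :: 'k poly_inf ring)"
    by unfold_locales auto
qed

lemma PIdl_quadratic_subalgebra:
  fixes a :: "'k::field poly_inf"
  assumes "a \<in> evens" "a \<noteq> 0"
  shows "PIdl\<^bsub>quadratic_subalgebra\<^esub> a = {y \<in> evens. a dvd y}"
proof safe
  fix y assume "y \<in> PIdl\<^bsub>quadratic_subalgebra\<^esub> a"
  then obtain x where "y = x * a" "x \<in> evens"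
    by (auto simp: cgenideal_def carrier_quadratic_subalgebra)
  thus "y \<in> evens" "a dvd y" using assms by (auto intro: evens_mult)
next
  fix y assume "y \<in> evens" "a dvd y"
  then obtain q where q: "y = a * q" by blast
  hence "q \<in> evens" using evens_factor \<open>y \<in> evens\<close> assms by blast
  thus "y \<in> PIdl\<^bsub>quadratic_subalgebra\<^esub> a"
    using q by (auto simp: cgenideal_def carrier_quadratic_subalgebra mult.commute)
qed

text \<open>
  A monomial of degree one in the product of an even polynomial and an odd polynomial \<open>q\<close> arises
  from the constant term of the even one and the same monomial of \<open>q\<close>. So if the indeterminate \<open>N\<close>
  is not a monomial of \<open>q\<close>, it is not a monomial of the product.
\<close>
lemma ideal_missing_indeterminate:
  fixes L :: "'k::field poly_inf"
  assumes "L \<in> odds"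
  shows "ideal {L * q | q. q \<in> odds \<and> single N 1 \<notin> keys q} quadratic_subalgebra"
proof -
  let ?D = "quadratic_subalgebra :: 'k poly_inf ring"
  interpret D: domain ?D by (rule domain_quadratic_subalgebra)
  define e where "e = single N (1::nat)"
  define J where "J = {L * q | q. q \<in> odds \<and> e \<notin> keys q}"
  have J_mult: "x * p \<in> J" if "p \<in> J" "x \<in> evens" for p x
  proof -
    from that obtain q where q: "p = L * q" "q \<in> odds" "e \<notin> keys q" by (auto simp: J_def)
    have "e \<notin> keys (x * q)"
    proof
      assume "e \<in> keys (x * q)"
      then obtain a b where ab: "a \<in> keys x" "b \<in> keys q" "e = a + b" by (rule in_keys_multE)
      have "mdeg a + mdeg b = 1"
        using arg_cong[OF ab(3), of mdeg] by (simp add: mdeg_add e_def)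
      moreover have "even (mdeg a)" "odd (mdeg b)"
        using ab that q by (auto simp: evens_def odds_def)
      ultimately have "mdeg a = 0" by presburger
      thus False using ab q by simp
    qed
    moreover have "x * q \<in> odds" using that q by (intro evens_odds_mult)
    ultimately show ?thesis unfolding J_def q(1) by (auto simp: mult.left_commute)
  qed
  have "subgroup J (add_monoid ?D)"
  proof (rule D.add.subgroupI)
    show "J \<subseteq> carrier ?D"
      using assms by (auto simp: J_def carrier_quadratic_subalgebra odds_mult)
    have "L * 0 \<in> J" unfolding J_def by (force intro: odds_0)
    thus "J \<noteq> {}" by blast
    fix p assume p: "p \<in> J"
    hence "p \<in> carrier ?D"
      using assms by (auto simp: J_def carrier_quadratic_subalgebra odds_mult)
    hence "\<ominus>\<^bsub>?D\<^esub> p = (- 1) * p"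
      by (intro D.minus_equality) (auto simp: carrier_quadratic_subalgebra evens_uminus)
    thus "\<ominus>\<^bsub>?D\<^esub> p \<in> J"
      using J_mult[OF p, of "- 1"] evens_uminus[OF evens_1] by simp
    fix p' assume "p' \<in> J"
    with p obtain q q' where "p = L * q" "q \<in> odds" "e \<notin> keys q"
      "p' = L * q'" "q' \<in> odds" "e \<notin> keys q'" by (auto simp: J_def)
    hence "p + p' = L * (q + q')" "q + q' \<in> odds" "e \<notin> keys (q + q')"
      using keys_add[of q q'] by (auto simp: distrib_left odds_add)
    thus "p \<oplus>\<^bsub>?D\<^esub> p' \<in> J" by (auto simp: J_def)
  qed
  moreover have "p * x \<in> J" if "p \<in> J" "x \<in> evens" for p x
    using J_mult[OF that] by (simp only: mult.commute)
  ultimately have "ideal J ?D"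
    by (intro idealI[OF D.ring_axioms]) (simp_all add: J_mult carrier_quadratic_subalgebra)
  thus ?thesis unfolding J_def e_def .
qed

text \<open>
  Finitely many generators \<open>L * r s\<close> miss some indeterminate \<open>N\<close>. They all lie in the ideal of
  \<open>ideal_missing_indeterminate\<close> for \<open>N\<close>, whereas \<open>L\<close> times the indeterminate \<open>N\<close> does not.
\<close>
lemma odd_multiples_not_finitely_generated:
  fixes L :: "'k::field poly_inf"
  assumes "L \<in> odds" "L \<noteq> 0"
  shows "\<not> finitely_generated_ideal {y \<in> evens. L dvd y} quadratic_subalgebra"
proof
  let ?D = "quadratic_subalgebra :: 'k poly_inf ring"
  interpret D: domain ?D by (rule domain_quadratic_subalgebra)
  assume "finitely_generated_ideal {y \<in> evens. L dvd y} ?D"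
  then obtain S where S: "S \<subseteq> evens" "finite S" "{y \<in> evens. L dvd y} = Idl\<^bsub>?D\<^esub> S"
    by (auto simp: finitely_generated_ideal_def carrier_quadratic_subalgebra)
  have "\<exists>r. s = L * r \<and> r \<in> odds" if "s \<in> S" for s
  proof -
    have "s \<in> evens" "L dvd s"
      using that S D.genideal_self[of S] by (auto simp: carrier_quadratic_subalgebra)
    thus ?thesis using odds_factor assms by blast
  qed
  then obtain r where r: "\<And>s. s \<in> S \<Longrightarrow> s = L * r s \<and> r s \<in> odds" by metis
  have "finite (\<Union>s\<in>S. \<Union>m\<in>keys (r s). keys m)"
    using S(2) by simp
  then obtain N where N: "N \<notin> (\<Union>s\<in>S. \<Union>m\<in>keys (r s). keys m)"
    using ex_new_if_finite infinite_UNIV_nat by blast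
  define e where "e = single N (1::nat)"
  define J where "J = {L * q | q. q \<in> odds \<and> e \<notin> keys q}"
  have "ideal J ?D"
    unfolding J_def e_def using assms(1) by (rule ideal_missing_indeterminate)
  moreover have "S \<subseteq> J"
  proof
    fix s assume s: "s \<in> S"
    have "e \<notin> keys (r s)"
    proof
      assume "e \<in> keys (r s)"
      hence "N \<notin> keys e" using N s by blast
      thus False by (simp add: e_def)
    qed
    thus "s \<in> J" using r[OF s] by (auto simp: J_def)
  qed
  ultimately have "Idl\<^bsub>?D\<^esub> S \<subseteq> J" by (rule D.genideal_minimal)
  moreover have "L * single e 1 \<in> {y \<in> evens. L dvd y}"
    using assms(1) by (auto simp: odds_def e_def intro!: odds_mult)
  ultimately have "L * single e 1 \<in> J" using S(3) by blast
  then obtain q where "L * single e 1 = L * q" "e \<notin> keys q" by (auto simp: J_def)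
  thus False using assms(2) by auto
qed

theorem theorem2p14:
  shows "bezout_intersection_domain (quadratic_subalgebra :: 'k::field poly_inf ring)"
  unfolding bezout_intersection_domain_def
proof (intro conjI allI impI domain_quadratic_subalgebra)
  let ?D = "quadratic_subalgebra :: 'k poly_inf ring"
  interpret D: domain ?D by (rule domain_quadratic_subalgebra)
  fix n :: nat and a :: "nat \<Rightarrow> 'k poly_inf"
  assume n: "2 \<le> n" and car: "\<forall>i<n. a i \<in> carrier ?D" and inc: "pairwise_incomparable ?D n a"
  have ev: "a i \<in> evens" if "i < n" for i
    using car that by (simp add: carrier_quadratic_subalgebra)
  \<comment> \<open>Zero lies in every ideal, so it is comparable to every element.\<close>
  have nz: "a i \<noteq> 0" if "i < n" for i
  proof
    assume "a i = 0"
    define j where "j = (if i = 0 then 1 else 0 :: nat)"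
    have "j < n" "j \<noteq> i" using n by (auto simp: j_def)
    moreover have "0 \<in> PIdl\<^bsub>?D\<^esub> (a j)"
      by (force simp: cgenideal_def carrier_quadratic_subalgebra)
    ultimately show False
      using inc that \<open>a i = 0\<close> unfolding pairwise_incomparable_def by metis
  qed
  have "finite (a ` {..<n})" "0 \<notin> a ` {..<n}"
    using nz by (auto simp: eq_commute[of 0])
  then obtain L where L: "L \<noteq> 0" "\<And>x. (\<forall>b\<in>a ` {..<n}. b dvd x) \<longleftrightarrow> L dvd x"
    using ex_lcm by metis
  have "(\<Inter>i<n. PIdl\<^bsub>?D\<^esub> (a i)) = (\<Inter>i<n. {y \<in> evens. a i dvd y})"
    using ev nz by (intro INF_cong refl PIdl_quadratic_subalgebra) auto
  also have "\<dots> = {y \<in> evens. L dvd y}"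
  proof -
    have "0 \<in> {..<n}" using n by simp
    hence "{..<n} \<noteq> {}" by blast
    thus ?thesis by (auto simp: L(2)[symmetric])
  qed
  finally have I: "(\<Inter>i<n. PIdl\<^bsub>?D\<^esub> (a i)) = {y \<in> evens. L dvd y}" .
  have "L \<in> evens \<or> L \<in> odds"
    using ev by (intro lcm_homogeneous[OF _ L]) auto
  thus "principalideal (\<Inter>i<n. PIdl\<^bsub>?D\<^esub> (a i)) ?D \<or>
        \<not> finitely_generated_ideal (\<Inter>i<n. PIdl\<^bsub>?D\<^esub> (a i)) ?D"
  proof
    assume "L \<in> evens"
    hence "(\<Inter>i<n. PIdl\<^bsub>?D\<^esub> (a i)) = PIdl\<^bsub>?D\<^esub> L"
      using I L(1) by (simp add: PIdl_quadratic_subalgebra)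
    thus ?thesis
      using D.cgenideal_is_principalideal \<open>L \<in> evens\<close> by (simp add: carrier_quadratic_subalgebra)
  next
    assume "L \<in> odds"
    thus ?thesis using odd_multiples_not_finitely_generated L(1) unfolding I by blast
  qed
qed

end
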